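(* Let $f\colon\mathbb{Q}\to\mathbb{Q}$ be an SD map. Then $f(x)=x$ for all $x\in\mathbb{Q}$.
   Context: An SD map on a field $\mathbb{F}$ is a function $f\colon \mathbb{F}\to\mathbb{F}$ such that for all $x \neq y$ in $\mathbb{F}$ one has $f(x)\neq f(y)$ and $f\left(\frac{x+y}{x-y}\right) = \frac{f(x)+f(y)}{f(x)-f(y)}$. *)

theory Defs
  imports Complex_Main
begin

definition SD_map :: "('a::field \<Rightarrow> 'a) \<Rightarrow> bool" where
  "SD_map f \<longleftrightarrow>
    (\<forall>x y. x \<noteq> y \<longrightarrow>
      f x \<noteq> f y \<and> f ((x + y) / (x - y)) = (f x + f y) / (f x - f y))"

end

theory Submission
  imports Defs
begin

text \<open>
  Setting one argument to 0 forces \<open>f 0 = 0\<close> and \<open>f 1 = 1\<close>; since \<open>(x + y) / (x - y)\<close> only depends on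
  \<open>x / y\<close>, the map is then multiplicative, and the functional equation becomes
  \<open>f (x + y) * (f x - f y) = f (x - y) * (f x + f y)\<close>. Computing \<open>f 5\<close> both from \<open>3 + 2\<close> and from
  \<open>4 + 1\<close> in terms of \<open>f 2\<close> yields \<open>f 2 = 2\<close>. The equation with \<open>y = 1\<close> then determines \<open>f\<close> on the
  natural numbers inductively, and multiplicativity extends this to the rationals.
\<close>

lemma SD_map_neq:
  assumes "SD_map f" "x \<noteq> y"
  shows "f x \<noteq> f y"
  using assms unfolding SD_map_def by blast

lemma SD_map_ratio:
  assumes "SD_map f" "x \<noteq> y"
  shows "f ((x + y) / (x - y)) = (f x + f y) / (f x - f y)"
  using assms unfolding SD_map_def by blast

lemma SD_map_0_1:
  fixes f :: "'a::field_char_0 \<Rightarrow> 'a"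
  assumes "SD_map f"
  shows "f 0 = 0" "f 1 = 1"
proof -
  have eq: "(f 1 - 1) * f x = f 0 * (f 1 + 1)" if "x \<noteq> 0" for x
    using SD_map_ratio[OF assms that] SD_map_neq[OF assms that] that
    by (simp add: field_simps)
  \<comment> \<open>The right-hand side of \<open>eq\<close> does not depend on \<open>x\<close>, so
    two nonzero arguments can be compared; injectivity of \<open>f\<close> then leaves only
    \<open>f 1 = 1\<close>.\<close>
  have "(f 1 - 1) * (f 1 - f 2) = 0"
    using eq[of 1] eq[of 2] by (simp add: algebra_simps)
  moreover have "f 1 \<noteq> f 2"
    by (rule SD_map_neq[OF assms]) simp
  ultimately show "f 1 = 1" by simp
  then show "f 0 = 0" using eq[of 1] by simp
qed

lemma SD_map_eq_0_iff:
  fixes f :: "'a::field_char_0 \<Rightarrow> 'a"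
  assumes "SD_map f"
  shows "f x = 0 \<longleftrightarrow> x = 0"
  using SD_map_neq[OF assms, of x 0] SD_map_0_1(1)[OF assms] by auto

text \<open>The pair \<open>x\<close>, \<open>- x\<close> has ratio 0, and \<open>f 0 = 0\<close>,
  so the numerator \<open>f x + f (- x)\<close> vanishes.\<close>

lemma SD_map_minus:
  fixes f :: "'a::field_char_0 \<Rightarrow> 'a"
  assumes "SD_map f"
  shows "f (- x) = - f x"
proof (cases "x = 0")
  case False
  then have "x \<noteq> - x" by (simp add: eq_neg_iff_add_eq_0)
  from SD_map_ratio[OF assms this] SD_map_neq[OF assms this] show ?thesis
    by (simp add: SD_map_0_1[OF assms] add_eq_0_iff)
qed (simp add: SD_map_0_1[OF assms])

text \<open>The pairs \<open>(x * y, y)\<close> and \<open>(x, 1)\<close> have the same ratio. Since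
  \<open>t \<mapsto> (t + 1) / (t - 1)\<close> is injective, \<open>f (x * y) / f y = f x\<close>.
  The cases set aside are those where a pair coincides or \<open>y\<close> cannot be
  cancelled.\<close>

lemma SD_map_mult:
  fixes f :: "'a::field_char_0 \<Rightarrow> 'a"
  assumes "SD_map f"
  shows "f (x * y) = f x * f y"
proof (cases "x = 1 \<or> y = 0")
  case False
  then have ne: "x \<noteq> 1" "x * y \<noteq> y" "y \<noteq> 0" by auto
  have "(x * y + y) / (x * y - y) = ((x + 1) * y) / ((x - 1) * y)"
    by (simp add: algebra_simps)
  also have "\<dots> = (x + 1) / (x - 1)"
    using ne(3) by simp
  finally have "(f (x * y) + f y) / (f (x * y) - f y) = (f x + 1) / (f x - 1)"
    using SD_map_ratio[OF assms ne(1)] SD_map_ratio[OF assms ne(2)] SD_map_0_1[OF assms]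
    by simp
  moreover have "f (x * y) - f y \<noteq> 0" "f x - 1 \<noteq> 0"
    using SD_map_neq[OF assms ne(1)] SD_map_neq[OF assms ne(2)] SD_map_0_1[OF assms]
    by auto
  ultimately have "(f (x * y) + f y) * (f x - 1) = (f x + 1) * (f (x * y) - f y)"
    by (simp add: frac_eq_eq)
  then have "2 * f (x * y) = 2 * (f x * f y)"
    by (simp add: algebra_simps)
  then show ?thesis by (simp only: mult_cancel_left) simp
qed (auto simp: SD_map_0_1[OF assms])

lemma SD_map_add_diff:
  fixes f :: "'a::field_char_0 \<Rightarrow> 'a"
  assumes "SD_map f"
  shows "f (x + y) * (f x - f y) = f (x - y) * (f x + f y)"
proof (cases "x = y")
  case False
  then have "f (x + y) = f ((x + y) / (x - y)) * f (x - y)"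
    by (simp flip: SD_map_mult[OF assms])
  with SD_map_ratio[OF assms False] SD_map_neq[OF assms False] show ?thesis
    by simp
qed (simp add: SD_map_0_1[OF assms])

lemma SD_map_2:
  fixes f :: "'a::field_char_0 \<Rightarrow> 'a"
  assumes "SD_map f"
  shows "f 2 = 2"
proof -
  define a b c where "a = f 2" and "b = f 3" and "c = f 5"
  note f1 = SD_map_0_1(2)[OF assms]
  have f4: "f 4 = a * a"
    using SD_map_mult[OF assms, of 2 2] by (simp add: a_def)
  have ne: "a \<noteq> 0" "c \<noteq> 0" "a - 1 \<noteq> 0"
    using SD_map_eq_0_iff[OF assms] SD_map_neq[OF assms, of 2 1] f1
    by (auto simp: a_def c_def)
  have b: "b * (a - 1) = a + 1"
    using SD_map_add_diff[OF assms, of 2 1] f1 by (simp add: a_def b_def)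
  have c32: "c * (b - a) = b + a"
    using SD_map_add_diff[OF assms, of 3 2] f1 by (simp add: a_def b_def c_def)
  have c41: "c * (a * a - 1) = b * (a * a + 1)"
    using SD_map_add_diff[OF assms, of 4 1] f1 by (simp add: f4 b_def c_def)
  have "c * (b - a) * (a - 1) = (b + a) * (a - 1)"
    by (simp add: c32)
  \<comment> \<open>The factor \<open>a - 1\<close> lets \<open>b * (a - 1)\<close> be replaced by
    \<open>a + 1\<close>, which eliminates \<open>b\<close>.\<close>
  then have 1: "c * (1 + 2 * a - a * a) = a * a + 1"
    using b by algebra
  have "b * (a - 1) * (c * (a - 1) * (a - 1)) = b * (a - 1) * (a * a + 1)"
    using b c41 by algebra
  moreover have "b * (a - 1) \<noteq> 0"
    using ne(3) SD_map_eq_0_iff[OF assms] by (auto simp: b_def)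
  ultimately have 2: "c * (a - 1) * (a - 1) = a * a + 1"
    by simp
  \<comment> \<open>Both expressions for \<open>a * a + 1\<close> are multiples of \<open>c\<close>;
    this is their difference.\<close>
  have "2 * (c * a * (a - 2)) = 0"
    using 1 2 by algebra
  with ne show ?thesis by (simp add: a_def)
qed

lemma SD_map_of_nat:
  fixes f :: "'a::field_char_0 \<Rightarrow> 'a"
  assumes "SD_map f"
  shows "f (of_nat n) = of_nat n"
proof (induction n rule: less_induct)
  case (less n)
  \<comment> \<open>The recursion from \<open>n - 1\<close> and \<open>n - 2\<close> to
    \<open>n\<close> carries the factor \<open>n - 2\<close>. At \<open>n = 2\<close> it reads 0 =
    0, which is why \<open>f 2\<close> needs its own lemma.\<close>
  consider "n = 0" | "n = 1" | "n = 2" | m where "n = m + 3"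
    using le_Suc_ex[of 3 n] by (fastforce simp: add.commute)
  then show ?case
  proof cases
    case 4
    have "f (of_nat (m + 2) + 1) * (f (of_nat (m + 2)) - f 1)
        = f (of_nat (m + 2) - 1) * (f (of_nat (m + 2)) + f 1)"
      by (rule SD_map_add_diff[OF assms])
    moreover have "of_nat (m + 2) + 1 = (of_nat n :: 'a)" "of_nat (m + 2) - 1 = (of_nat (m + 1) :: 'a)"
      by (simp_all add: 4)
    ultimately have "of_nat (m + 1) * f (of_nat n) = of_nat (m + 1) * (of_nat n :: 'a)"
      using less.IH[of "m + 2"] less.IH[of "m + 1"]
      by (simp add: 4 SD_map_0_1[OF assms] algebra_simps)
    moreover have "of_nat (m + 1) \<noteq> (0 :: 'a)"
      by (simp only: of_nat_eq_0_iff)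
    ultimately show ?thesis
      by (simp only: mult_cancel_left) simp
  qed (simp_all add: SD_map_0_1[OF assms] SD_map_2[OF assms])
qed

lemma SD_map_of_int:
  fixes f :: "'a::field_char_0 \<Rightarrow> 'a"
  assumes "SD_map f"
  shows "f (of_int k) = of_int k"
  by (cases k rule: int_cases2) (simp_all add: SD_map_of_nat[OF assms] SD_map_minus[OF assms])

text \<open>Clearing the denominator reduces this to integers. Thus \<open>f\<close> fixes the prime
  field of any field of characteristic 0; on \<open>rat\<close> itself \<open>of_rat\<close> is the
  identity.\<close>

lemma SD_map_of_rat:
  fixes f :: "'a::field_char_0 \<Rightarrow> 'a"
  assumes "SD_map f"
  shows "f (of_rat q) = of_rat q"
proof -
  obtain a b where q: "q = Fract a b" "b > 0"
    by (cases q) auto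
  define r where "r = (of_rat q :: 'a)"
  have r: "r * of_int b = of_int a"
    using q by (simp add: r_def of_rat_rat)
  have "f r * of_int b = f (r * of_int b)"
    by (simp add: SD_map_mult[OF assms] SD_map_of_int[OF assms])
  also have "\<dots> = r * of_int b"
    by (simp only: r SD_map_of_int[OF assms])
  finally have "f r * of_int b = r * of_int b" .
  then show ?thesis using q(2) by (simp add: r_def)
qed

theorem theorem3p1:
  fixes f :: "rat \<Rightarrow> rat"
  assumes "SD_map f"
  shows "\<forall>x. f x = x"
  using SD_map_of_rat[OF assms] by simp

end
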